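(* Let $X$ be a topological space with Rothberger's property $\mathsf{S}_1(\mathrm{O},\mathrm{O})$. Then Alice does not have a winning strategy in Rothberger's game $\mathsf{G}_1(\mathrm{O},\mathrm{O})$ played on $X$.
   Context: An open cover of $X$ is a family of open subsets of $X$ whose union is $X$. No separation axioms are assumed. Rothberger's property $\mathsf{S}_1(\mathrm{O},\mathrm{O})$: for each sequence $\mathcal{U}_1,\mathcal{U}_2,\dots$ of open covers of $X$ there are elements $U_1\in\mathcal{U}_1,\ U_2\in\mathcal{U}_2,\dots$ such that the family $\{U_1,U_2,\dots\}$ covers $X$. Rothberger's game $\mathsf{G}_1(\mathrm{O},\mathrm{O})$: a game for two players, Alice and Bob, with one inning for each natural number $n=1,2,\dots$. In inning $n$, Alice picks an open cover $\mathcal{U}_n$ of $X$, and then Bob selects one element $U_n\in\mathcal{U}_n$. Bob wins the play if $\{U_1,U_2,\dots\}$ covers $X$; otherwise Alice wins. A strategy for Alice is a function assigning to each finite sequence (possibly empty) of previous legal moves of Bob the open cover that Alice plays next; it is winning if Alice wins every play in which she follows it. *)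

theory Defs
  imports "HOL-Analysis.Abstract_Topology"
begin

definition open_cover :: "'a topology \<Rightarrow> 'a set set \<Rightarrow> bool" where
  "open_cover X \<U> \<longleftrightarrow> (\<forall>U\<in>\<U>. openin X U) \<and> \<Union>\<U> = topspace X"

(* Innings are indexed from 0. The empty family is an open cover of the empty space;
   no element can be selected from it, so the empty space does not have this property. *)
definition rothberger :: "'a topology \<Rightarrow> bool" where
  "rothberger X \<longleftrightarrow>
     (\<forall>\<U> :: nat \<Rightarrow> 'a set set. (\<forall>n. open_cover X (\<U> n)) \<longrightarrow>
        (\<exists>U. (\<forall>n. U n \<in> \<U> n) \<and> open_cover X (range U)))"

definition rothberger_play :: "'a topology \<Rightarrow> (nat \<Rightarrow> 'a set set) \<Rightarrow> (nat \<Rightarrow> 'a set) \<Rightarrow> bool" where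
  "rothberger_play X \<U> U \<longleftrightarrow> (\<forall>n. open_cover X (\<U> n) \<and> U n \<in> \<U> n)"

definition bob_wins :: "'a topology \<Rightarrow> (nat \<Rightarrow> 'a set) \<Rightarrow> bool" where
  "bob_wins X U \<longleftrightarrow> open_cover X (range U)"

(* Finite sequences of moves, oldest first, that Bob can legally have made against \<sigma>. *)
definition legal_moves :: "('a set list \<Rightarrow> 'a set set) \<Rightarrow> 'a set list \<Rightarrow> bool" where
  "legal_moves \<sigma> us \<longleftrightarrow> (\<forall>i<length us. us ! i \<in> \<sigma> (take i us))"

(* The values of \<sigma> on sequences that are not legal are irrelevant. *)
definition alice_strategy :: "'a topology \<Rightarrow> ('a set list \<Rightarrow> 'a set set) \<Rightarrow> bool" where
  "alice_strategy X \<sigma> \<longleftrightarrow> (\<forall>us. legal_moves \<sigma> us \<longrightarrow> open_cover X (\<sigma> us))"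

definition follows_strategy ::
    "('a set list \<Rightarrow> 'a set set) \<Rightarrow> (nat \<Rightarrow> 'a set set) \<Rightarrow> (nat \<Rightarrow> 'a set) \<Rightarrow> bool" where
  "follows_strategy \<sigma> \<U> U \<longleftrightarrow> (\<forall>n. \<U> n = \<sigma> (map U [0..<n]))"

definition alice_winning_strategy :: "'a topology \<Rightarrow> ('a set list \<Rightarrow> 'a set set) \<Rightarrow> bool" where
  "alice_winning_strategy X \<sigma> \<longleftrightarrow> alice_strategy X \<sigma> \<and>
     (\<forall>\<U> U. rothberger_play X \<U> U \<and> follows_strategy \<sigma> \<U> U \<longrightarrow> \<not> bob_wins X U)"

end

(* Rothberger's property makes Alice's covers countable, so her strategy is a tree of sets W s j
   indexed by finite sequences s of naturals, where the sets W s j (j = 0, 1, ...) cover X for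
   each s.
   For a function f let F n be the finite set of positions s of length n with s ! i <= f i for all
   i < n.  By a Hurewicz-type argument f can be chosen so that each point x belongs, for infinitely
   many n, to a set W s j with j <= f n for every s in F n simultaneously: Bob's unions are
   accumulated along the play, so that the intersection of all unions reachable in n innings is
   still open, and thus an inning-by-inning selection no longer depends on the earlier moves.
   Hence the families of the intersections of W s (h s) over s in F n, with h s <= f n, cover each
   point for infinitely many n.  Rothberger's property, applied to the intersections of m + 1
   members of distinct families, yields one h for each n such that the corresponding sets
   cover X.  Bob answers h n s in inning n at position s. *)
theory Submission
  imports Defs "HOL-Library.Nat_Bijection"
begin

section \<open>Open covers and selections from them\<close>

lemma open_coverI:
  assumes "\<And>U. U \<in> \<U> \<Longrightarrow> openin X U" and "\<And>x. x \<in> topspace X \<Longrightarrow> \<exists>U\<in>\<U>. x \<in> U"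
  shows "open_cover X \<U>"
  unfolding open_cover_def using assms openin_subset by fast

lemma open_cover_rangeI:
  assumes "\<And>n. openin X (B n)" and "\<And>x. x \<in> topspace X \<Longrightarrow> \<exists>n. x \<in> B n"
  shows "open_cover X (range B)"
  by (rule open_coverI) (use assms in auto)

lemma rothbergerE:
  fixes \<U> :: "nat \<Rightarrow> 'a set set"
  assumes "rothberger X" and "\<And>n. open_cover X (\<U> n)"
  obtains V where "\<And>n. V n \<in> \<U> n" and "open_cover X (range V)"
  using assms(1)[unfolded rothberger_def, rule_format, of \<U>] assms(2) by blast

lemma rothberger_select:
  fixes B :: "nat \<Rightarrow> nat \<Rightarrow> 'a set"
  assumes "rothberger X" and "\<And>n. open_cover X (range (B n))"
  obtains f where "(\<Union>n. B n (f n)) = topspace X"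
proof -
  obtain U where U: "\<And>n. U n \<in> range (B n)" "open_cover X (range U)"
    using rothbergerE[OF assms(1), of "\<lambda>n. range (B n)"] assms(2) by blast
  then have "\<forall>n. \<exists>k. U n = B n k" by auto
  then obtain f where "\<And>n. U n = B n (f n)" by metis
  with U(2) show ?thesis
    using that[of f] unfolding open_cover_def by simp
qed

text \<open>A selection from a constant sequence of covers is a countable subcover.\<close>

lemma rothberger_countable_subcover:
  assumes "rothberger X" and "open_cover X \<U>"
  obtains e :: "nat \<Rightarrow> 'a set" where "\<And>j. e j \<in> \<U>" and "open_cover X (range e)"
  using rothbergerE[OF assms(1), of "\<lambda>_. \<U>"] assms(2) by blast

section \<open>Accumulated unions along a play\<close>

definition accum :: "(nat list \<Rightarrow> nat \<Rightarrow> 'a set) \<Rightarrow> nat list \<Rightarrow> 'a set" where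
  "accum Q \<tau> = (\<Union>j<length \<tau>. Q (take j \<tau>) (\<tau> ! j))"

text \<open>This is the intersection of \<open>accum Q (\<tau> @ \<sigma> @ [m])\<close> over all
  \<open>\<sigma>\<close> of length \<open>n\<close>, taken one move at a time so that openness can
  be proved by induction.\<close>

primrec inter_accum :: "(nat list \<Rightarrow> nat \<Rightarrow> 'a set) \<Rightarrow> nat \<Rightarrow> nat list \<Rightarrow> nat \<Rightarrow> 'a set" where
  "inter_accum Q 0 \<tau> m = accum Q (\<tau> @ [m])"
| "inter_accum Q (Suc n) \<tau> m = (\<Inter>k. inter_accum Q n (\<tau> @ [k]) m)"

lemma accum_snoc: "accum Q (\<tau> @ [k]) = accum Q \<tau> \<union> Q \<tau> k"
  by (simp add: accum_def lessThan_Suc nth_append Un_commute)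

lemma accum_map_upt: "accum Q (map f [0..<n]) = (\<Union>j<n. Q (map f [0..<j]) (f j))"
  unfolding accum_def by (auto simp: take_map)

lemma inter_accum_subset:
  "length \<sigma> = n \<Longrightarrow> inter_accum Q n \<tau> m \<subseteq> accum Q (\<tau> @ \<sigma> @ [m])"
proof (induction n arbitrary: \<sigma> \<tau>)
  case (Suc n)
  then obtain k \<rho> where "\<sigma> = k # \<rho>" "length \<rho> = n" by (cases \<sigma>) auto
  then show ?case using Suc.IH[of \<rho> "\<tau> @ [k]"] by auto
qed simp

lemma accum_subset_inter_accum: "accum Q \<tau> \<subseteq> inter_accum Q n \<tau> m"
proof (induction n arbitrary: \<tau>)
  case (Suc n)
  have "accum Q \<tau> \<subseteq> inter_accum Q n (\<tau> @ [k]) m" for k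
    using Suc[of "\<tau> @ [k]"] by (auto simp: accum_snoc)
  then show ?case by auto
qed (auto simp: accum_snoc)

context
  fixes X :: "'a topology" and Q :: "nat list \<Rightarrow> nat \<Rightarrow> 'a set"
  assumes cover: "\<And>\<tau>. open_cover X (range (Q \<tau>))" and mono: "\<And>\<tau>. mono (Q \<tau>)"
begin

lemma openin_accum: "openin X (accum Q \<tau>)"
  using cover unfolding accum_def open_cover_def by (intro openin_Union) auto

lemma accum_snoc_mono: "k \<le> l \<Longrightarrow> accum Q (\<tau> @ [k]) \<subseteq> accum Q (\<tau> @ [l])"
  using monoD[OF mono[of \<tau>], of k l] by (auto simp: accum_snoc)

lemma accum_snoc_covers:
  assumes "x \<in> topspace X"
  obtains k where "x \<in> accum Q (\<tau> @ [k])"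
  using assms cover[of \<tau>] unfolding open_cover_def by (auto simp: accum_snoc)

lemma inter_accum_mono: "k \<le> l \<Longrightarrow> inter_accum Q n \<tau> k \<subseteq> inter_accum Q n \<tau> l"
proof (induction n arbitrary: \<tau>)
  case (Suc n)
  then show ?case by (auto intro!: INF_mono)
qed (simp add: accum_snoc_mono)

text \<open>Near a point of \<open>accum Q (\<tau> @ [k0])\<close> only the finitely many moves below \<open>k0\<close> constrain
  the intersection, since accumulated unions are increasing in the last move.\<close>

lemma inter_accum_local:
  "accum Q (\<tau> @ [k0]) \<inter> (\<Inter>k<k0. inter_accum Q n (\<tau> @ [k]) m) \<subseteq> inter_accum Q (Suc n) \<tau> m"
proof -
  have "accum Q (\<tau> @ [k0]) \<subseteq> inter_accum Q n (\<tau> @ [k]) m" if "k0 \<le> k" for k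
    using accum_snoc_mono[OF that] accum_subset_inter_accum by (metis subset_trans)
  then have "x \<in> inter_accum Q n (\<tau> @ [k]) m"
    if "x \<in> accum Q (\<tau> @ [k0]) \<inter> (\<Inter>k<k0. inter_accum Q n (\<tau> @ [k]) m)" for x k
    using that by (cases "k < k0") (auto simp: not_less)
  then show ?thesis by auto
qed

text \<open>By induction: around each point the next infinite intersection reduces to a finite one.
  For \<open>\<tau> = []\<close> these covers depend on the inning alone, not on the
  history.\<close>

lemma open_cover_inter_accum: "open_cover X (range (inter_accum Q n \<tau>))"
proof (induction n arbitrary: \<tau>)
  case 0
  show ?case
    by (rule open_cover_rangeI) (auto intro: openin_accum elim: accum_snoc_covers[of _ \<tau>])
next
  case (Suc n)
  have IH_open: "openin X (inter_accum Q n \<rho> m)" for \<rho> m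
    using Suc unfolding open_cover_def by auto
  have IH_cover: "(\<Union>m. inter_accum Q n \<rho> m) = topspace X" for \<rho>
    using Suc unfolding open_cover_def by auto
  define N where
    "N k0 m = accum Q (\<tau> @ [k0]) \<inter> (\<Inter>k<k0. inter_accum Q n (\<tau> @ [k]) m)" for k0 m
  have N_open: "openin X (N k0 m)" for k0 m
  proof (cases "k0 = 0")
    case False
    then show ?thesis
      unfolding N_def by (intro openin_Int openin_accum openin_INT2 IH_open) auto
  qed (simp add: N_def openin_accum)
  have N_sub: "N k0 m \<subseteq> inter_accum Q (Suc n) \<tau> m" for k0 m
    unfolding N_def by (rule inter_accum_local)
  have "openin X (inter_accum Q (Suc n) \<tau> m)" for m
  proof (subst openin_subopen, intro ballI)
    fix x assume x: "x \<in> inter_accum Q (Suc n) \<tau> m"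
    then have "x \<in> topspace X"
      using openin_subset[OF IH_open] by auto
    then obtain k0 where "x \<in> accum Q (\<tau> @ [k0])" by (rule accum_snoc_covers)
    with x have "x \<in> N k0 m" by (simp add: N_def)
    then show "\<exists>T. openin X T \<and> x \<in> T \<and> T \<subseteq> inter_accum Q (Suc n) \<tau> m"
      by (intro exI[of _ "N k0 m"] conjI N_open N_sub)
  qed
  moreover have "\<exists>m. x \<in> inter_accum Q (Suc n) \<tau> m" if x: "x \<in> topspace X" for x
  proof -
    obtain k0 where k0: "x \<in> accum Q (\<tau> @ [k0])"
      using x by (rule accum_snoc_covers)
    have "\<exists>m. x \<in> inter_accum Q n (\<tau> @ [k]) m" for k
      using x IH_cover[of "\<tau> @ [k]"] by auto
    then obtain \<mu> where \<mu>: "\<And>k. x \<in> inter_accum Q n (\<tau> @ [k]) (\<mu> k)" by metis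
    \<comment> \<open>One index serves all moves below \<open>k0\<close>, since
      \<open>inter_accum\<close> grows with its last argument.\<close>
    define M where "M = Max (\<mu> ` {..k0})"
    have "\<mu> k \<le> M" if "k < k0" for k
      unfolding M_def using that by (intro Max_ge) auto
    then have "x \<in> inter_accum Q n (\<tau> @ [k]) M" if "k < k0" for k
      using \<mu> inter_accum_mono that by blast
    with k0 have "x \<in> N k0 M" by (auto simp: N_def)
    then show ?thesis using N_sub by blast
  qed
  ultimately show ?case
    by (rule open_cover_rangeI)
qed

end

section \<open>Hurewicz's theorem\<close>

text \<open>The set selected by Bob is counted for row \<open>i\<close> only when its index exceeds \<open>i\<close>. A
  point covered in every row is then covered in infinitely many innings, because finitely many
  innings use a bounded set of indices.\<close>

lemma rothberger_covers_infinitely_often: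
  fixes Q :: "nat list \<Rightarrow> nat \<Rightarrow> 'a set"
  assumes "rothberger X"
    and cover: "\<And>\<tau>. open_cover X (range (Q \<tau>))" and mono: "\<And>\<tau>. mono (Q \<tau>)"
  obtains f where "\<And>x. x \<in> topspace X \<Longrightarrow> \<exists>\<^sub>\<infinity>n. x \<in> Q (map f [0..<n]) (f n)"
proof -
  define R where "R i \<tau> k = (if i < k then Q \<tau> k else {})" for i :: nat and \<tau> k
  have R_mono: "mono (R i \<tau>)" for i \<tau>
    using monoD[OF mono[of \<tau>]] by (auto simp: mono_def R_def)
  have R_cover: "open_cover X (range (R i \<tau>))" for i \<tau>
  proof -
    have "x \<in> R i \<tau> (max k (Suc i))" if "x \<in> Q \<tau> k" for x k
      using that monoD[OF mono[of \<tau>], of k "max k (Suc i)"] by (auto simp: R_def)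
    then have "(\<Union>k. Q \<tau> k) \<subseteq> (\<Union>k. R i \<tau> k)" by blast
    moreover have "(\<Union>k. R i \<tau> k) \<subseteq> (\<Union>k. Q \<tau> k)" by (auto simp: R_def split: if_splits)
    ultimately show ?thesis
      using cover[of \<tau>] unfolding open_cover_def by (auto simp: R_def)
  qed
  \<comment> \<open>The innings \<open>prod_encode (i, n)\<close> form row \<open>i\<close>;
    Rothberger's property is applied to each row separately, and \<open>f\<close> merges the
    selections.\<close>
  have "\<exists>g. (\<Union>n. inter_accum (R i) (prod_encode (i, n)) [] (g n)) = topspace X" for i
    by (rule rothberger_select[OF assms(1), of "\<lambda>n. inter_accum (R i) (prod_encode (i, n)) []"])
      (use open_cover_inter_accum[of X "R i", OF R_cover R_mono] in blast)+
  then obtain g where g: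
    "\<And>i. (\<Union>n. inter_accum (R i) (prod_encode (i, n)) [] (g i n)) = topspace X" by metis
  define f where "f p = (case prod_decode p of (i, n) \<Rightarrow> g i n)" for p
  have "\<exists>\<^sub>\<infinity>n. x \<in> Q (map f [0..<n]) (f n)" if x: "x \<in> topspace X" for x
  proof -
    have ex: "\<exists>j. i < f j \<and> x \<in> Q (map f [0..<j]) (f j)" for i
    proof -
      obtain n where n: "x \<in> inter_accum (R i) (prod_encode (i, n)) [] (g i n)"
        using x g[of i] by blast
      define p where "p = prod_encode (i, n)"
      have "x \<in> inter_accum (R i) p [] (f p)"
        using n by (simp add: p_def f_def)
      \<comment> \<open>The choice in inning \<open>p\<close> works against all histories of length
        \<open>p\<close>, in particular the one produced by \<open>f\<close> itself.\<close>
      then have "x \<in> accum (R i) (map f [0..<Suc p])"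
        using inter_accum_subset[of "map f [0..<p]" p "R i" "[]" "f p"] by auto
      then show ?thesis
        unfolding accum_map_upt by (auto simp: R_def split: if_splits)
    qed
    show ?thesis
    proof (rule ccontr)
      assume "\<not> ?thesis"
      then have "finite {n. x \<in> Q (map f [0..<n]) (f n)}"
        by (simp add: frequently_cofinite)
      then have "\<forall>n \<in> {n. x \<in> Q (map f [0..<n]) (f n)}. f n \<le> Max (f ` {n. x \<in> Q (map f [0..<n]) (f n)})"
        by auto
      then show False using ex by (metis (no_types, lifting) mem_Collect_eq not_less)
    qed
  qed
  then show ?thesis by (rule that)
qed

section \<open>Selecting from families that cover each point infinitely often\<close>

text \<open>Greedy choice: before stage \<open>m\<close> at most \<open>m\<close> elements are
  taken, so \<open>I m\<close> still has a free one.\<close>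

lemma injective_choice:
  fixes I :: "nat \<Rightarrow> 'b set"
  assumes "\<And>m. finite (I m)" and "\<And>m. m < card (I m)"
  obtains p where "inj p" and "\<And>m. p m \<in> I m"
proof -
  have "\<exists>p. \<forall>m. p m \<in> I m - p ` {..<m}"
  proof (rule dependent_wf_choice[of less_than])
    fix m and p :: "nat \<Rightarrow> 'b"
    have "card (p ` {..<m}) < card (I m)"
      using card_image_le[of "{..<m}" p] assms(2)[of m] by simp
    then have "\<not> I m \<subseteq> p ` {..<m}"
      by (meson card_mono finite_imageI finite_lessThan not_less)
    then show "\<exists>r. r \<in> I m - p ` {..<m}" by blast
  next
    fix p q :: "nat \<Rightarrow> 'b" and m r
    assume "\<And>z. (z, m) \<in> less_than \<Longrightarrow> p z = q z"
    then have "p ` {..<m} = q ` {..<m}" by (intro image_cong) auto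
    then show "(r \<in> I m - p ` {..<m}) = (r \<in> I m - q ` {..<m})" by simp
  qed simp
  then obtain p where p: "\<And>m. p m \<in> I m - p ` {..<m}" by blast
  have "inj p"
    by (rule linorder_injI) (metis DiffD2 imageI lessThan_iff p)
  moreover have "p m \<in> I m" for m using p[of m] by simp
  ultimately show ?thesis by (rule that)
qed

text \<open>An intersection of \<open>m + 1\<close> members can be charged to any of
  \<open>m + 1\<close> innings, which is room enough to charge different \<open>m\<close> to
  different innings.\<close>

lemma rothberger_select_infinitely_often:
  assumes "rothberger X"
    and op: "\<And>n D. D \<in> \<D> n \<Longrightarrow> openin X D" and ne: "\<And>n. \<D> n \<noteq> {}"
    and inf: "\<And>x. x \<in> topspace X \<Longrightarrow> \<exists>\<^sub>\<infinity>n. x \<in> \<Union>(\<D> n)"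
  obtains V where "\<And>n. V n \<in> \<D> n" and "topspace X \<subseteq> (\<Union>n. V n)"
proof -
  define \<U> where
    "\<U> m = {\<Inter>n\<in>I. w n | I w. finite I \<and> card I = Suc m \<and> (\<forall>n\<in>I. w n \<in> \<D> n)}" for m
  have "open_cover X (\<U> m)" for m
  proof -
    have U_open: "openin X U" if "U \<in> \<U> m" for U
    proof -
      from that obtain I w where "U = (\<Inter>n\<in>I. w n)" "finite I" "card I = Suc m"
        "\<forall>n\<in>I. w n \<in> \<D> n"
        unfolding \<U>_def by (elim CollectE exE conjE) (rule that)
      moreover from this have "I \<noteq> {}" by auto
      ultimately show ?thesis using op by (auto intro!: openin_INT2)
    qed
    moreover have "x \<in> \<Union>(\<U> m)" if x: "x \<in> topspace X" for x
    proof -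
      have "infinite {n. x \<in> \<Union>(\<D> n)}"
        using inf[OF x] by (simp add: frequently_cofinite)
      then obtain I where I: "I \<subseteq> {n. x \<in> \<Union>(\<D> n)}" "card I = Suc m" "finite I"
        by (meson infinite_arbitrarily_large)
      have "\<forall>n\<in>I. \<exists>D\<in>\<D> n. x \<in> D" using I(1) by auto
      then obtain w where "\<forall>n\<in>I. w n \<in> \<D> n \<and> x \<in> w n" by metis
      with I have "(\<Inter>n\<in>I. w n) \<in> \<U> m" "x \<in> (\<Inter>n\<in>I. w n)"
        by (auto simp: \<U>_def intro!: exI[of _ I] exI[of _ w])
      then show ?thesis by blast
    qed
    ultimately show ?thesis
      by (intro open_coverI) blast+
  qed
  then obtain T where T: "\<And>m. T m \<in> \<U> m" "open_cover X (range T)"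
    using rothbergerE[OF assms(1), of \<U>] by blast
  have "\<forall>m. \<exists>I w. T m = (\<Inter>n\<in>I. w n) \<and> finite I \<and> card I = Suc m \<and> (\<forall>n\<in>I. w n \<in> \<D> n)"
    using T(1) by (simp add: \<U>_def)
  then obtain I w where Iw: "\<And>m. T m = (\<Inter>n\<in>I m. w m n)" "\<And>m. finite (I m)"
    "\<And>m. card (I m) = Suc m" "\<And>m n. n \<in> I m \<Longrightarrow> w m n \<in> \<D> n" by metis
  obtain p where p: "inj p" "\<And>m. p m \<in> I m"
    using injective_choice[of I] Iw(2,3) by (metis lessI)
  \<comment> \<open>In inning \<open>p m\<close> the factor of \<open>T m\<close> with that index is
    selected, a superset of \<open>T m\<close>; innings outside \<open>range p\<close> get an
    arbitrary member.\<close>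
  define V where
    "V n = (if n \<in> range p then w (inv p n) n else (SOME D. D \<in> \<D> n))" for n
  have "V n \<in> \<D> n" for n
    using ne[of n] Iw(4) p by (auto simp: V_def some_in_eq)
  moreover have "topspace X \<subseteq> (\<Union>n. V n)"
  proof
    fix x assume "x \<in> topspace X"
    then obtain m where "x \<in> T m" using T(2) unfolding open_cover_def by blast
    then have "x \<in> V (p m)" using p Iw(1)[of m] by (auto simp: V_def)
    then show "x \<in> (\<Union>n. V n)" by blast
  qed
  ultimately show ?thesis by (rule that)
qed

section \<open>Bob's counterplay\<close>

lemma finite_list_all2_le: "finite {s. list_all2 (\<le>) s (\<tau> :: nat list)}"
proof (induction \<tau>)
  case (Cons a \<tau>)
  have "{s. list_all2 (\<le>) s (a # \<tau>)} = (\<lambda>(b, s). b # s) ` ({..a} \<times> {s. list_all2 (\<le>) s \<tau>})"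
    by (auto simp: list_all2_Cons2 image_iff)
  with Cons show ?case by simp
qed simp

lemma course_of_values_ex:
  fixes h :: "nat \<Rightarrow> 'b list \<Rightarrow> 'b"
  shows "\<exists>g. \<forall>n. g n = h n (map g [0..<n])"
proof (rule dependent_wf_choice[of less_than])
  fix g g' :: "nat \<Rightarrow> 'b" and n r
  assume "\<And>z. (z, n) \<in> less_than \<Longrightarrow> g z = g' z"
  then have "map g [0..<n] = map g' [0..<n]" by simp
  then show "(r = h n (map g [0..<n])) = (r = h n (map g' [0..<n]))" by metis
qed simp_all

text \<open>Below a bounding function only finitely many positions occur in each inning, so answers
  for all of them can be prepared at once; the branch then follows the prepared answers.\<close>

lemma rothberger_branch_covers:
  fixes W :: "nat list \<Rightarrow> nat \<Rightarrow> 'a set"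
  assumes "rothberger X" and cover: "\<And>s. open_cover X (range (W s))"
  obtains g where "topspace X \<subseteq> (\<Union>n. W (map g [0..<n]) (g n))"
proof -
  have W_open: "openin X (W s j)" for s j
    using cover[of s] unfolding open_cover_def by auto
  define F where "F \<tau> = {s. list_all2 (\<le>) s (\<tau> :: nat list)}" for \<tau>
  have F_fin: "finite (F \<tau>)" for \<tau>
    unfolding F_def by (rule finite_list_all2_le)
  have F_ne: "F \<tau> \<noteq> {}" for \<tau>
    unfolding F_def by (auto intro: list_all2_refl)
  \<comment> \<open>The unions make \<open>Q \<tau>\<close> increasing, as accumulation requires;
    finiteness of \<open>F \<tau>\<close> keeps the intersection open and gives a common bound
    \<open>k\<close>.\<close>
  define Q where "Q \<tau> k = (\<Inter>s\<in>F \<tau>. \<Union>j\<le>k. W s j)" for \<tau> k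
  have Q_mono: "mono (Q \<tau>)" for \<tau>
  proof (rule monoI)
    fix k l :: nat assume "k \<le> l"
    then have "(\<Union>j\<le>k. W s j) \<subseteq> (\<Union>j\<le>l. W s j)" for s by (intro UN_mono) auto
    then show "Q \<tau> k \<subseteq> Q \<tau> l" unfolding Q_def by (intro INF_mono) blast
  qed
  have Q_cover: "open_cover X (range (Q \<tau>))" for \<tau>
  proof -
    have Q_open: "openin X (Q \<tau> k)" for k
      unfolding Q_def by (intro openin_INT2 F_fin F_ne openin_Union) (auto simp: W_open)
    moreover have "\<exists>k. x \<in> Q \<tau> k" if x: "x \<in> topspace X" for x
    proof -
      have "\<exists>j. x \<in> W s j" for s
        using x cover[of s] unfolding open_cover_def by auto
      then obtain \<mu> where \<mu>: "\<And>s. x \<in> W s (\<mu> s)" by metis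
      have "\<mu> s \<le> Max (\<mu> ` F \<tau>)" if "s \<in> F \<tau>" for s
        using that F_fin by auto
      with \<mu> have "x \<in> Q \<tau> (Max (\<mu> ` F \<tau>))" unfolding Q_def by blast
      then show ?thesis ..
    qed
    ultimately show ?thesis
      by (rule open_cover_rangeI)
  qed
  obtain f where
    f: "\<And>x. x \<in> topspace X \<Longrightarrow> \<exists>\<^sub>\<infinity>n. x \<in> Q (map f [0..<n]) (f n)"
    by (rule rothberger_covers_infinitely_often[OF assms(1), of Q, OF Q_cover Q_mono]) (rule that)
  define P where "P n = F (map f [0..<n])" for n
  \<comment> \<open>A member fixes answers at all positions in \<open>P n\<close>, whichever of them
    is reached.\<close>
  define \<D> where
    "\<D> n = {\<Inter>s\<in>P n. W s (h s) | h. \<forall>s\<in>P n. h s \<le> f n}" for n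
  have D_open: "D \<in> \<D> n \<Longrightarrow> openin X D" for D n
    unfolding \<D>_def P_def using F_fin F_ne W_open by (auto intro!: openin_INT2)
  have D_ne: "\<D> n \<noteq> {}" for n
  proof -
    have "(\<Inter>s\<in>P n. W s 0) \<in> \<D> n" unfolding \<D>_def by (auto intro!: exI[of _ "\<lambda>_. 0"])
    then show ?thesis by blast
  qed
  have D_inf: "\<exists>\<^sub>\<infinity>n. x \<in> \<Union>(\<D> n)" if "x \<in> topspace X" for x
  proof (rule frequently_mono[OF _ f[OF that]], intro allI impI)
    fix n assume "x \<in> Q (map f [0..<n]) (f n)"
    then have "\<forall>s\<in>P n. \<exists>j\<le>f n. x \<in> W s j" unfolding Q_def P_def by auto
    then obtain h where "\<forall>s\<in>P n. h s \<le> f n \<and> x \<in> W s (h s)" by metis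
    then show "x \<in> \<Union>(\<D> n)" by (auto simp: \<D>_def intro!: exI[of _ "\<Inter>s\<in>P n. W s (h s)"] exI[of _ h])
  qed
  obtain V where V: "\<And>n. V n \<in> \<D> n" "topspace X \<subseteq> (\<Union>n. V n)"
    by (rule rothberger_select_infinitely_often[OF assms(1), of \<D>, OF D_open D_ne D_inf])
      (assumption+, rule that)
  have "\<forall>n. \<exists>h. V n = (\<Inter>s\<in>P n. W s (h s)) \<and> (\<forall>s\<in>P n. h s \<le> f n)"
    using V(1) by (simp add: \<D>_def)
  then obtain h where
    h: "\<And>n. V n = (\<Inter>s\<in>P n. W s (h n s))" "\<And>n s. s \<in> P n \<Longrightarrow> h n s \<le> f n" by metis
  \<comment> \<open>The branch \<open>g\<close> takes the prepared answers; as these are bounded by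
    \<open>f\<close>, it never leaves the sets \<open>P n\<close>.\<close>
  obtain g where g: "\<And>n. g n = h n (map g [0..<n])" using course_of_values_ex[of h] by blast
  have g_in: "map g [0..<n] \<in> P n" for n
  proof (induction n)
    case (Suc n)
    then have "g n \<le> f n" using h(2)[of "map g [0..<n]" n] g[of n] by simp
    with Suc show ?case by (auto simp: P_def F_def intro: list_all2_appendI)
  qed (simp add: P_def F_def)
  have "V n \<subseteq> W (map g [0..<n]) (g n)" for n
    using g_in[of n] g[of n] h(1)[of n] by auto
  then have "topspace X \<subseteq> (\<Union>n. W (map g [0..<n]) (g n))"
    by (rule order_trans[OF V(2) SUP_mono'])
  then show ?thesis by (rule that)
qed

lemma legal_moves_snoc:
  "legal_moves \<sigma> us \<Longrightarrow> u \<in> \<sigma> us \<Longrightarrow> legal_moves \<sigma> (us @ [u])"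
  unfolding legal_moves_def by (auto simp: nth_append less_Suc_eq)

theorem theorem7:
  fixes X :: "'a topology"
  assumes "rothberger X"
  shows "\<not> (\<exists>\<sigma>. alice_winning_strategy X \<sigma>)"
proof
  assume "\<exists>\<sigma>. alice_winning_strategy X \<sigma>"
  then obtain \<sigma> where strat: "alice_strategy X \<sigma>" and
    wins: "\<And>\<U> U. rothberger_play X \<U> U \<Longrightarrow> follows_strategy \<sigma> \<U> U \<Longrightarrow> \<not> bob_wins X U"
    unfolding alice_winning_strategy_def by blast
  \<comment> \<open>The guard is needed because \<open>\<sigma>\<close> yields covers only at legal
    sequences.\<close>
  have "\<forall>us. \<exists>e :: nat \<Rightarrow> 'a set. legal_moves \<sigma> us \<longrightarrow>
      (\<forall>j. e j \<in> \<sigma> us) \<and> open_cover X (range e)"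
    using strat rothberger_countable_subcover[OF assms] unfolding alice_strategy_def by metis
  then obtain e :: "'a set list \<Rightarrow> nat \<Rightarrow> 'a set" where
    e_in: "\<And>us j. legal_moves \<sigma> us \<Longrightarrow> e us j \<in> \<sigma> us" and
    e_cover: "\<And>us. legal_moves \<sigma> us \<Longrightarrow> open_cover X (range (e us))" by metis
  \<comment> \<open>Translates indices into moves of Bob: \<open>j\<close> stands for the
    \<open>j\<close>-th set of the countable subcover at the current position.\<close>
  define pos where "pos = foldl (\<lambda>us j. us @ [e us j]) []"
  have pos_snoc: "pos (s @ [j]) = pos s @ [e (pos s) j]" for s j
    by (simp add: pos_def)
  have pos_legal: "legal_moves \<sigma> (pos s)" for s
  proof (induction s rule: rev_induct)
    case Nil
    show ?case by (simp add: pos_def legal_moves_def)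
  next
    case (snoc j s)
    then show ?case unfolding pos_snoc by (intro legal_moves_snoc e_in)
  qed
  obtain g where g: "topspace X \<subseteq> (\<Union>n. e (pos (map g [0..<n])) (g n))"
    using rothberger_branch_covers[OF assms, of "\<lambda>s. e (pos s)"] e_cover pos_legal by blast
  define U where "U n = e (pos (map g [0..<n])) (g n)" for n
  \<comment> \<open>Tree positions along \<open>g\<close> are exactly Bob's histories in the play
    \<open>U\<close>.\<close>
  have pos_U: "pos (map g [0..<n]) = map U [0..<n]" for n
  proof (induction n)
    case 0
    show ?case by (simp add: pos_def)
  next
    case (Suc n)
    then show ?case by (simp add: pos_snoc U_def)
  qed
  define \<U> where "\<U> n = \<sigma> (map U [0..<n])" for n
  have legal: "legal_moves \<sigma> (map U [0..<n])" for n
    using pos_legal pos_U by metis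
  have U_in: "U n \<in> \<U> n" for n
    using e_in[OF legal] pos_U by (simp add: \<U>_def U_def)
  have U_cover: "open_cover X (\<U> n)" for n
    using strat legal unfolding alice_strategy_def \<U>_def by blast
  have "rothberger_play X \<U> U"
    using U_in U_cover unfolding rothberger_play_def by blast
  moreover have "follows_strategy \<sigma> \<U> U"
    unfolding follows_strategy_def \<U>_def by blast
  moreover have "bob_wins X U"
  proof -
    have "openin X (U n)" for n
      using U_in U_cover unfolding open_cover_def by blast
    moreover have "topspace X \<subseteq> \<Union>(range U)" using g by (simp add: U_def)
    ultimately show ?thesis
      unfolding bob_wins_def by (intro open_coverI) blast+
  qed
  ultimately show False using wins by blast
qed

end
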